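(* Let $B = B(F_n)$ be a generalized Bratteli diagram defined by a sequence of incidence matrices $(F_n)_{n\ge 0}$. Suppose that there exists some level $k$ such that, for all finite subsets $W\subset V_{k}$, $$\liminf_{n\to\infty} \left( \sup_{v\in V_{n}}\frac{\sum_{w\in W}H_{w}^{(k)}h_{v,w}^{(n,k)}}{H_{v}^{(n)}}\right) =0,$$ where, for $n>k$, $h_{v,w}^{(n,k)}$ denotes the number of finite paths between the vertices $w \in W\subset V_k$ and $v \in V_n$. Then $B$ admits no probability tail invariant measure, i.e. there is no tail invariant Borel probability measure on the path space $X_B$.
   Context: A generalized Bratteli diagram $B=(V,E)$ is a graded graph with vertex set $V=\bigsqcup_{n\ge 0}V_n$ and edge set $E=\bigsqcup_{n\ge 0}E_n$, where every $V_n$ is countably infinite, each edge $e\in E_n$ has a source $s(e)\in V_n$ and a range $r(e)\in V_{n+1}$ (multiple edges are allowed), $s^{-1}(v)\neq\emptyset$ for every $v\in V$, and $r^{-1}(v)$ is nonempty and finite for every $v\in V\setminus V_0$. The incidence matrices are $F_n=(f^{(n)}_{v,w})_{v\in V_{n+1},\,w\in V_n}$, where $f^{(n)}_{v,w}\in\{0,1,2,\dots\}$ is the number of edges from $w\in V_n$ to $v\in V_{n+1}$; the sequence $(F_n)$ determines $B$, written $B=B(F_n)$. The path space $X_B$ is the set of infinite edge sequences $(x_0,x_1,\dots)$ with $x_i\in E_i$ and $r(x_i)=s(x_{i+1})$ for all $i$ (so paths start in $V_0$). For a finite path $\overline e=(e_0,\dots,e_n)$ starting in $V_0$, set $r(\overline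 e)=r(e_n)$, and let $[\overline e]=\{x\in X_B: x_i=e_i,\ 0\le i\le n\}$ be the associated cylinder set; cylinder sets form a base of clopen sets of the (Polish, zero-dimensional) topology of $X_B$. Two paths $x,y\in X_B$ are tail equivalent if $x_i=y_i$ for all sufficiently large $i$. Standing assumptions: $X_B$ has no isolated points, and the tail equivalence relation is aperiodic (all classes are infinite). A Borel measure $\mu$ on $X_B$ is tail invariant if $\mu([\overline e])=\mu([\overline e'])$ whenever $\overline e,\overline e'$ are finite paths starting at level $0$ with $r(\overline e)=r(\overline e')$. For $v\in V_n$, $n\ge 1$, $H^{(n)}_v=\sum_{w\in V_0}(F_{n-1}\cdots F_0)_{v,w}$ is the total (finite) number of finite paths from $V_0$ to $v$, and $H^{(0)}_v=1$ for $v\in V_0$. For $n>k$, $h^{(n,k)}_{v,w}=(F_{n-1}\cdots F_k)_{v,w}$. *)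

theory Defs
  imports "HOL-Probability.Probability"
begin

record ('v, 'e) bratteli =
  verts :: "nat \<Rightarrow> 'v set"
  edges :: "nat \<Rightarrow> 'e set"
  src :: "'e \<Rightarrow> 'v"
  rng :: "'e \<Rightarrow> 'v"

definition generalized_bratteli_diagram :: "('v, 'e) bratteli \<Rightarrow> bool" where
  "generalized_bratteli_diagram B \<longleftrightarrow>
     disjoint_family (verts B) \<and> disjoint_family (edges B) \<and>
     (\<forall>n. countable (verts B n) \<and> infinite (verts B n)) \<and>
     (\<forall>n. \<forall>e\<in>edges B n. src B e \<in> verts B n \<and> rng B e \<in> verts B (Suc n)) \<and>
     (\<forall>n. \<forall>v\<in>verts B n. {e \<in> edges B n. src B e = v} \<noteq> {}) \<and>
     (\<forall>n. \<forall>v\<in>verts B (Suc n).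
        {e \<in> edges B n. rng B e = v} \<noteq> {} \<and> finite {e \<in> edges B n. rng B e = v})"

definition incidence :: "('v, 'e) bratteli \<Rightarrow> nat \<Rightarrow> 'v \<Rightarrow> 'v \<Rightarrow> nat" where
  "incidence B n v w = card {e \<in> edges B n. src B e = w \<and> rng B e = v}"

text \<open>\<^term>\<open>incidence_prod B k m\<close> is the product $F_{k+m-1} \cdots F_k$ of \<open>m\<close> incidence matrices
  (the identity for \<open>m = 0\<close>), a matrix indexed by $V_{k+m} \times V_k$. The index sets are infinite
  but the rows have finite support; \<^term>\<open>sum'\<close> is summation over the support, whereas
  \<^term>\<open>sum\<close> would be \<open>0\<close> on these sets.\<close>

primrec incidence_prod :: "('v, 'e) bratteli \<Rightarrow> nat \<Rightarrow> nat \<Rightarrow> 'v \<Rightarrow> 'v \<Rightarrow> nat" where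
  "incidence_prod B k 0 v w = (if v = w then 1 else 0)"
| "incidence_prod B k (Suc m) v w =
     sum' (\<lambda>u. incidence B (k + m) v u * incidence_prod B k m u w) (verts B (k + m))"

text \<open>Only meant for \<open>n \<ge> k\<close>.\<close>

definition path_count :: "('v, 'e) bratteli \<Rightarrow> nat \<Rightarrow> nat \<Rightarrow> 'v \<Rightarrow> 'v \<Rightarrow> nat" where
  "path_count B n k v w = incidence_prod B k (n - k) v w"

definition vertex_height :: "('v, 'e) bratteli \<Rightarrow> nat \<Rightarrow> 'v \<Rightarrow> nat" where
  "vertex_height B n v = sum' (\<lambda>w. path_count B n 0 v w) (verts B 0)"

definition path_space :: "('v, 'e) bratteli \<Rightarrow> (nat \<Rightarrow> 'e) set" where
  "path_space B = {x. \<forall>i. x i \<in> edges B i \<and> rng B (x i) = src B (x (Suc i))}"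

text \<open>The finite paths $(e_0, \dots, e_n)$, \<open>n \<ge> 0\<close>, starting at level 0.\<close>

definition finite_paths :: "('v, 'e) bratteli \<Rightarrow> 'e list set" where
  "finite_paths B = {es. es \<noteq> [] \<and> (\<forall>i<length es. es ! i \<in> edges B i) \<and>
     (\<forall>i. Suc i < length es \<longrightarrow> rng B (es ! i) = src B (es ! Suc i))}"

definition cylinder :: "('v, 'e) bratteli \<Rightarrow> 'e list \<Rightarrow> (nat \<Rightarrow> 'e) set" where
  "cylinder B es = {x \<in> path_space B. \<forall>i<length es. x i = es ! i}"

definition path_topology :: "('v, 'e) bratteli \<Rightarrow> (nat \<Rightarrow> 'e) topology" where
  "path_topology B = topology_generated_by (cylinder B ` finite_paths B)"

definition path_borel :: "('v, 'e) bratteli \<Rightarrow> (nat \<Rightarrow> 'e) measure" where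
  "path_borel B = sigma (path_space B) {U. openin (path_topology B) U}"

definition no_isolated_points :: "('v, 'e) bratteli \<Rightarrow> bool" where
  "no_isolated_points B \<longleftrightarrow> (\<forall>x\<in>path_space B. \<not> openin (path_topology B) {x})"

definition tail_equiv :: "('v, 'e) bratteli \<Rightarrow> ((nat \<Rightarrow> 'e) \<times> (nat \<Rightarrow> 'e)) set" where
  "tail_equiv B = {(x, y). x \<in> path_space B \<and> y \<in> path_space B \<and> (\<exists>N. \<forall>i\<ge>N. x i = y i)}"

definition tail_aperiodic :: "('v, 'e) bratteli \<Rightarrow> bool" where
  "tail_aperiodic B \<longleftrightarrow> (\<forall>x\<in>path_space B. infinite (tail_equiv B `` {x}))"

definition tail_invariant :: "('v, 'e) bratteli \<Rightarrow> (nat \<Rightarrow> 'e) measure \<Rightarrow> bool" where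
  "tail_invariant B \<mu> \<longleftrightarrow> sets \<mu> = sets (path_borel B) \<and>
     (\<forall>es\<in>finite_paths B. \<forall>es'\<in>finite_paths B. rng B (last es) = rng B (last es') \<longrightarrow>
        emeasure \<mu> (cylinder B es) = emeasure \<mu> (cylinder B es'))"

end

theory Submission
  imports Defs
begin

text \<open>Let \<open>\<mu>\<close> be a tail invariant probability measure and \<open>n > k\<close>. Cut the path space according to the
  vertex \<open>v\<close> visited at level \<open>n\<close>. The piece of \<open>v\<close> is the disjoint union of the \<open>H\<^sub>v\<close> cylinders of
  finite paths ending at \<open>v\<close>, and by tail invariance these have the same mass \<open>p\<^sub>v\<close>. Exactly
  \<open>H\<^sub>w * h\<^sub>v\<^sub>w\<close> of these finite paths visit \<open>w\<close> at level \<open>k\<close>. So, inside the piece of \<open>v\<close>, the paths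
  through \<open>w\<close> have the proportion \<open>H\<^sub>w * h\<^sub>v\<^sub>w / H\<^sub>v\<close> of the mass, whatever \<open>\<mu>\<close> is. Summing over \<open>v\<close>,
  the set of all paths through \<open>w\<close> has measure at most the supremum of these proportions over
  \<open>v \<in> V\<^sub>n\<close> (\<open>measure_through_vertex_le\<close>). Letting \<open>n\<close> tend to infinity, the hypothesis for the
  singletons \<open>W = {w}\<close> makes that set null. As \<open>V\<^sub>k\<close> is countable, the whole path space is null,
  which a probability measure does not allow.

  What the informal argument takes for granted is that the matrix products count paths. This is
  \<open>card_extensions\<close>, which is stated for extensions of an arbitrary family of lists
  so that it yields both counts: all paths ending at \<open>v\<close>, and those that visit \<open>w\<close> on the way.\<close>

section \<open>Counting finite paths by incidence matrices\<close>

text \<open>A list that records the edges below level \<open>k\<close> does not determine the vertex it ends at when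
  \<open>k = 0\<close>. Therefore a set of finite paths is a family indexed by the end vertex: \<open>A w\<close> holds the
  paths that end at \<open>w \<in> V\<^sub>k\<close>, and \<open>extensions B k A m v\<close> holds their continuations by \<open>m\<close> edges
  that end at \<open>v \<in> V\<^bsub>k + m\<^esub>\<close>.\<close>

primrec extensions ::
    "('v, 'e) bratteli \<Rightarrow> nat \<Rightarrow> ('v \<Rightarrow> 'e list set) \<Rightarrow> nat \<Rightarrow> 'v \<Rightarrow> 'e list set" where
  "extensions B k A 0 v = A v"
| "extensions B k A (Suc m) v =
     (\<Union>e\<in>{e \<in> edges B (k + m). rng B e = v}. (\<lambda>es. es @ [e]) ` extensions B k A m (src B e))"

abbreviation initial_paths :: "('v, 'e) bratteli \<Rightarrow> nat \<Rightarrow> 'v \<Rightarrow> 'e list set" where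
  "initial_paths B n v \<equiv> extensions B 0 (\<lambda>_. {[]}) n v"

lemma snoc_mem_extensions:
  "es @ [e] \<in> extensions B k A (Suc m) v \<longleftrightarrow>
     e \<in> edges B (k + m) \<and> rng B e = v \<and> es \<in> extensions B k A m (src B e)"
  by auto

lemma extensions_mono:
  assumes "\<And>u. A u \<subseteq> A' u"
  shows "extensions B k A m v \<subseteq> extensions B k A' m v"
proof (induction m arbitrary: v)
  case (Suc m)
  then show ?case
    unfolding extensions.simps by (intro UN_mono image_mono) auto
qed (use assms in auto)

lemma extensions_extensions:
  "extensions B k (\<lambda>u. extensions B 0 A k u) m v = extensions B 0 A (k + m) v"
  by (induction m arbitrary: v) auto

lemma sum'_eq_sum_superset:
  assumes "finite S" "S \<subseteq> I" "\<And>x. x \<in> I - S \<Longrightarrow> f x = 0"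
  shows "sum' f I = sum f S"
  using sum.mono_neutral_left'[of S I f] sum.eq_sum[of S f] assms by simp

lemma finite_edges_into:
  assumes "generalized_bratteli_diagram B" "v \<in> verts B (Suc n)"
  shows "finite {e \<in> edges B n. rng B e = v}"
  using assms by (auto simp: generalized_bratteli_diagram_def)

lemma src_in_verts:
  assumes "generalized_bratteli_diagram B" "e \<in> edges B n"
  shows "src B e \<in> verts B n"
  using assms by (auto simp: generalized_bratteli_diagram_def)

text \<open>Only the sources of the finitely many edges into \<open>v\<close> contribute, so that the row of the product
  at \<open>v\<close> is a finite combination of rows of the previous product. In this form the sums over last
  edges and over vertices of level \<open>k\<close> can be exchanged by the rules for ordinary finite sums.\<close>

lemma incidence_prod_Suc:
  assumes "generalized_bratteli_diagram B" "v \<in> verts B (Suc (k + m))"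
  shows "incidence_prod B k (Suc m) v w =
    (\<Sum>u\<in>src B ` {e \<in> edges B (k + m). rng B e = v}.
       incidence B (k + m) v u * incidence_prod B k m u w)"
proof -
  have "incidence B (k + m) v u = 0"
    if "u \<notin> src B ` {e \<in> edges B (k + m). rng B e = v}" for u
  proof -
    from that have no_edge: "{e \<in> edges B (k + m). src B e = u \<and> rng B e = v} = {}" by auto
    show ?thesis unfolding incidence_def no_edge by simp
  qed
  then show ?thesis
    unfolding incidence_prod.simps
    using finite_edges_into[OF assms] src_in_verts[OF assms(1)]
    by (intro sum'_eq_sum_superset) auto
qed

lemma finite_incidence_prod_support:
  assumes "generalized_bratteli_diagram B" "v \<in> verts B (k + m)"
  shows "finite {w. incidence_prod B k m v w \<noteq> 0}"
  using assms(2)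
proof (induction m arbitrary: v)
  case (Suc m)
  let ?U = "src B ` {e \<in> edges B (k + m). rng B e = v}"
  have v: "v \<in> verts B (Suc (k + m))" using Suc.prems by simp
  have "{w. incidence_prod B k (Suc m) v w \<noteq> 0} \<subseteq> (\<Union>u\<in>?U. {w. incidence_prod B k m u w \<noteq> 0})"
    unfolding incidence_prod_Suc[OF assms(1) v]
    by (rule subsetI) (auto elim!: sum.not_neutral_contains_not_neutral simp del: sum_eq_0_iff neq0_conv)
  moreover have "finite (\<Union>u\<in>?U. {w. incidence_prod B k m u w \<noteq> 0})"
    using finite_edges_into[OF assms(1) v] Suc.IH src_in_verts[OF assms(1)] by blast
  ultimately show ?case by (rule finite_subset)
qed auto

lemma card_extensions_Suc:
  assumes "generalized_bratteli_diagram B" "v \<in> verts B (Suc (k + m))"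
    and "\<And>u. u \<in> verts B (k + m) \<Longrightarrow> finite (extensions B k A m u)"
  shows "card (extensions B k A (Suc m) v) =
    (\<Sum>u\<in>src B ` {e \<in> edges B (k + m). rng B e = v}.
       incidence B (k + m) v u * card (extensions B k A m u))"
proof -
  let ?E = "{e \<in> edges B (k + m). rng B e = v}"
  have fE: "finite ?E" by (rule finite_edges_into[OF assms(1,2)])
  have "card (extensions B k A (Suc m) v)
      = (\<Sum>e\<in>?E. card ((\<lambda>es. es @ [e]) ` extensions B k A m (src B e)))"
    unfolding extensions.simps
    using fE assms(3) src_in_verts[OF assms(1)] by (intro card_UN_disjoint) auto
  also have "\<dots> = (\<Sum>e\<in>?E. card (extensions B k A m (src B e)))"
    by (intro sum.cong refl card_image) (auto simp: inj_on_def)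
  also have "\<dots> = (\<Sum>u\<in>src B ` ?E. \<Sum>e\<in>{e \<in> ?E. src B e = u}. card (extensions B k A m (src B e)))"
    by (rule sum.image_gen[OF fE])
  also have "\<dots> = (\<Sum>u\<in>src B ` ?E. incidence B (k + m) v u * card (extensions B k A m u))"
  proof (rule sum.cong[OF refl])
    fix u
    have "{e \<in> ?E. src B e = u} = {e \<in> edges B (k + m). src B e = u \<and> rng B e = v}" by auto
    then show "(\<Sum>e\<in>{e \<in> ?E. src B e = u}. card (extensions B k A m (src B e)))
        = incidence B (k + m) v u * card (extensions B k A m u)"
      by (simp add: incidence_def)
  qed
  finally show ?thesis .
qed

lemma finite_extensions:
  assumes "generalized_bratteli_diagram B" "\<And>w. w \<in> verts B k \<Longrightarrow> finite (A w)"
    and "v \<in> verts B (k + m)"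
  shows "finite (extensions B k A m v)"
  using assms(3)
proof (induction m arbitrary: v)
  case (Suc m)
  then show ?case
    using finite_edges_into[OF assms(1), of v "k + m"] src_in_verts[OF assms(1)] by auto
qed (use assms in auto)

text \<open>Both sides satisfy the same recursion in \<open>m\<close>, which splits off the last edge. A single finite set
  \<open>W\<close> of start vertices serves for all sources of last edges, which permits the exchange of sums.\<close>

lemma card_extensions:
  assumes B: "generalized_bratteli_diagram B"
    and A: "\<And>w. w \<in> verts B k \<Longrightarrow> finite (A w)"
    and "v \<in> verts B (k + m)"
  shows "card (extensions B k A m v) = sum' (\<lambda>w. incidence_prod B k m v w * card (A w)) (verts B k)"
  using assms(3)
proof (induction m arbitrary: v)
  case 0
  then have "sum' (\<lambda>w. incidence_prod B k 0 v w * card (A w)) (verts B k)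
      = (\<Sum>w\<in>{v}. incidence_prod B k 0 v w * card (A w))"
    by (intro sum'_eq_sum_superset) auto
  then show ?case by simp
next
  case (Suc m)
  let ?U = "src B ` {e \<in> edges B (k + m). rng B e = v}"
  let ?p = "incidence_prod B k m"
  define W where "W = (\<Union>u\<in>?U. {w \<in> verts B k. ?p u w \<noteq> 0})"
  have v: "v \<in> verts B (Suc (k + m))" using Suc.prems by simp
  have U: "u \<in> verts B (k + m)" if "u \<in> ?U" for u
    using that src_in_verts[OF B] by auto
  have finU: "finite ?U" using finite_edges_into[OF B v] by simp
  have finW: "finite W"
    unfolding W_def
  proof (rule finite_UN_I[OF finU])
    fix u assume "u \<in> ?U"
    from finite_incidence_prod_support[OF B U[OF this]]
    show "finite {w \<in> verts B k. ?p u w \<noteq> 0}" by (rule finite_subset[rotated]) auto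
  qed
  have W_sub: "W \<subseteq> verts B k" by (auto simp: W_def)
  have IH: "card (extensions B k A m u) = (\<Sum>w\<in>W. ?p u w * card (A w))" if "u \<in> ?U" for u
    unfolding Suc.IH[OF U[OF that]]
    using that finW W_sub by (intro sum'_eq_sum_superset) (auto simp: W_def)
  have "card (extensions B k A (Suc m) v)
      = (\<Sum>u\<in>?U. incidence B (k + m) v u * card (extensions B k A m u))"
    using card_extensions_Suc[OF B v] finite_extensions[of B k A] B A by blast
  also have "\<dots> = (\<Sum>u\<in>?U. \<Sum>w\<in>W. incidence B (k + m) v u * ?p u w * card (A w))"
    using IH by (intro sum.cong) (auto simp: sum_distrib_left mult.assoc)
  also have "\<dots> = (\<Sum>w\<in>W. \<Sum>u\<in>?U. incidence B (k + m) v u * ?p u w * card (A w))"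
    by (rule sum.swap)
  also have "\<dots> = (\<Sum>w\<in>W. incidence_prod B k (Suc m) v w * card (A w))"
    unfolding incidence_prod_Suc[OF B v] sum_distrib_right ..
  also have "\<dots> = sum' (\<lambda>w. incidence_prod B k (Suc m) v w * card (A w)) (verts B k)"
  proof (rule sum'_eq_sum_superset[symmetric, OF finW W_sub])
    fix w assume "w \<in> verts B k - W"
    then have "?p u w = 0" if "u \<in> ?U" for u using that by (auto simp: W_def)
    then show "incidence_prod B k (Suc m) v w * card (A w) = 0"
      unfolding incidence_prod_Suc[OF B v] by simp
  qed
  finally show ?case .
qed

lemma card_initial_paths:
  assumes "generalized_bratteli_diagram B" "v \<in> verts B n"
  shows "card (initial_paths B n v) = vertex_height B n v"
  using card_extensions[of B 0 "\<lambda>_. {[]}" v n] assms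
  by (simp add: vertex_height_def path_count_def)

abbreviation initial_paths_through :: "('v, 'e) bratteli \<Rightarrow> nat \<Rightarrow> 'v \<Rightarrow> nat \<Rightarrow> 'v \<Rightarrow> 'e list set" where
  "initial_paths_through B k w m v \<equiv>
     extensions B k (\<lambda>u. if u = w then initial_paths B k u else {}) m v"

lemma initial_paths_through_subset:
  "initial_paths_through B k w m v \<subseteq> initial_paths B (k + m) v"
proof -
  have "initial_paths_through B k w m v \<subseteq> extensions B k (\<lambda>u. initial_paths B k u) m v"
    by (rule extensions_mono) auto
  then show ?thesis unfolding extensions_extensions .
qed

lemma card_initial_paths_through:
  assumes B: "generalized_bratteli_diagram B" and "w \<in> verts B k" "v \<in> verts B (k + m)"
  shows "card (initial_paths_through B k w m v) = vertex_height B k w * path_count B (k + m) k v w"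
proof -
  let ?A = "\<lambda>u. if u = w then initial_paths B k u else {}"
  have "card (initial_paths_through B k w m v)
      = sum' (\<lambda>u. incidence_prod B k m v u * card (?A u)) (verts B k)"
    using card_extensions[of B k ?A v m] finite_extensions[of B 0 "\<lambda>_. {[]}" _ k] assms by simp
  also have "\<dots> = (\<Sum>u\<in>{w}. incidence_prod B k m v u * card (?A u))"
    using assms by (intro sum'_eq_sum_superset) auto
  finally show ?thesis
    using card_initial_paths[OF B assms(2)] by (simp add: path_count_def mult.commute)
qed

section \<open>Decomposing the path space into cylinders\<close>

lemma initial_paths_valid:
  assumes "es \<in> initial_paths B n v"
  shows "length es = n \<and> (\<forall>i<n. es ! i \<in> edges B i) \<and>
    (\<forall>i. Suc i < n \<longrightarrow> rng B (es ! i) = src B (es ! Suc i)) \<and> (0 < n \<longrightarrow> rng B (es ! (n - 1)) = v)"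
  using assms
proof (induction n arbitrary: v es)
  case (Suc n)
  from Suc.prems obtain e fs where es: "es = fs @ [e]" and e: "e \<in> edges B n" "rng B e = v"
    and fs: "fs \<in> initial_paths B n (src B e)" by auto
  note IH = Suc.IH[OF fs]
  have "rng B (es ! i) = src B (es ! Suc i)" if "Suc i < Suc n" for i
    using that IH by (cases "Suc i = n") (auto simp: es nth_append)
  moreover have "es ! i \<in> edges B i" if "i < Suc n" for i
    using that IH e by (cases "i = n") (auto simp: es nth_append)
  ultimately show ?case using IH e by (auto simp: es nth_append)
qed auto

lemma initial_paths_finite_paths:
  assumes "es \<in> initial_paths B n v" "0 < n"
  shows "es \<in> finite_paths B" "rng B (last es) = v"
  using initial_paths_valid[OF assms(1)] assms(2)
  by (auto simp: finite_paths_def last_conv_nth)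

lemma prefix_mem_extensions:
  assumes "x \<in> path_space B"
  shows "map x [0..<k + m] \<in> extensions B k A m (src B (x (k + m))) \<longleftrightarrow>
    map x [0..<k] \<in> A (src B (x k))"
proof (induction m)
  case (Suc m)
  have "x (k + m) \<in> edges B (k + m)" "rng B (x (k + m)) = src B (x (k + Suc m))"
    using assms by (auto simp: path_space_def)
  then show ?case
    using Suc.IH snoc_mem_extensions[of "map x [0..<k + m]" "x (k + m)" B k A m] by simp
qed simp

text \<open>The last edge of a nonempty path determines its end vertex, hence the condition \<open>0 < m\<close>.\<close>

lemma prefix_mem_extensions_iff:
  assumes "x \<in> path_space B" "0 < m"
  shows "map x [0..<k + m] \<in> extensions B k A m v \<longleftrightarrow>
    src B (x (k + m)) = v \<and> map x [0..<k] \<in> A (src B (x k))"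
proof -
  obtain l where m: "m = Suc l" using assms(2) by (cases m) auto
  have "rng B (x (k + l)) = src B (x (k + m))"
    using assms by (auto simp: path_space_def m)
  then have "src B (x (k + m)) = v" if "map x [0..<k + m] \<in> extensions B k A m v"
    using that snoc_mem_extensions[of "map x [0..<k + l]" "x (k + l)" B k A l v] by (simp add: m)
  then show ?thesis using prefix_mem_extensions[OF assms(1), of k m A] by blast
qed

lemma prefix_mem_initial_paths_iff:
  assumes "x \<in> path_space B" "0 < n"
  shows "map x [0..<n] \<in> initial_paths B n v \<longleftrightarrow> src B (x n) = v"
  using prefix_mem_extensions_iff[of x B n 0 "\<lambda>_. {[]}" v] assms by simp

lemma prefix_mem_initial_paths_through_iff:
  assumes "x \<in> path_space B" "0 < m"
  shows "map x [0..<k + m] \<in> initial_paths_through B k w m v \<longleftrightarrow>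
    src B (x (k + m)) = v \<and> src B (x k) = w"
  using prefix_mem_extensions_iff[OF assms] prefix_mem_extensions[OF assms(1), of 0 k "\<lambda>_. {[]}"]
  by auto

lemma mem_cylinder_iff:
  "x \<in> cylinder B es \<longleftrightarrow> x \<in> path_space B \<and> map x [0..<length es] = es"
  by (simp add: cylinder_def list_eq_iff_nth_eq[of _ es])

lemma space_path_borel: "space (path_borel B) = path_space B"
  and cylinder_in_sets_path_borel:
    "es \<in> finite_paths B \<Longrightarrow> cylinder B es \<in> sets (path_borel B)"
proof -
  have "topspace (path_topology B) \<subseteq> path_space B"
    by (auto simp: path_topology_def topology_generated_by_topspace cylinder_def)
  then have sub: "{U. openin (path_topology B) U} \<subseteq> Pow (path_space B)"
    using openin_subset[of "path_topology B"] by blast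
  show "space (path_borel B) = path_space B"
    unfolding path_borel_def using sub by (rule space_measure_of)
  assume "es \<in> finite_paths B"
  then have "openin (path_topology B) (cylinder B es)"
    unfolding path_topology_def by (intro topology_generated_by_Basis) auto
  then show "cylinder B es \<in> sets (path_borel B)"
    unfolding path_borel_def sets_measure_of[OF sub] by (intro sigma_sets.Basic) auto
qed

text \<open>The cylinders of distinct paths of the same length are disjoint, and by tail invariance they all
  have the same mass when the paths end at the same vertex. So the mass of a set of such paths is
  proportional to its cardinality, and an inequality between cardinalities carries over to masses.\<close>

lemma emeasure_cylinders_le:
  assumes B: "generalized_bratteli_diagram B" and \<mu>: "tail_invariant B \<mu>"
    and v: "v \<in> verts B n" and n: "0 < n"
    and S: "S \<subseteq> initial_paths B n v"
    and c: "0 \<le> c" "real (card S) \<le> c * real (card (initial_paths B n v))"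
  shows "(\<Union>es\<in>S. cylinder B es) \<in> sets \<mu>"
    and "emeasure \<mu> (\<Union>es\<in>S. cylinder B es)
      \<le> ennreal c * emeasure \<mu> (\<Union>es\<in>initial_paths B n v. cylinder B es)"
proof -
  let ?T = "initial_paths B n v"
  have finT: "finite ?T" using finite_extensions[of B 0 "\<lambda>_. {[]}" v n] B v by simp
  have finS: "finite S" using finT S by (rule finite_subset[rotated])
  have meas: "cylinder B es \<in> sets \<mu>" if "es \<in> ?T" for es
    using cylinder_in_sets_path_borel initial_paths_finite_paths(1)[OF that n] \<mu>
    by (auto simp: tail_invariant_def)
  show "(\<Union>es\<in>S. cylinder B es) \<in> sets \<mu>" using meas S finS by (intro sets.finite_UN) auto
  have disj: "disjoint_family_on (cylinder B) ?T"
    by (auto simp: disjoint_family_on_def mem_cylinder_iff dest!: initial_paths_valid)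
  show "emeasure \<mu> (\<Union>es\<in>S. cylinder B es) \<le> ennreal c * emeasure \<mu> (\<Union>es\<in>?T. cylinder B es)"
  proof (cases "S = {}")
    case False
    then obtain fs where fs: "fs \<in> S" by auto
    let ?p = "emeasure \<mu> (cylinder B fs)"
    have same: "emeasure \<mu> (cylinder B es) = ?p" if "es \<in> ?T" for es
      using \<mu> initial_paths_finite_paths[OF that n] initial_paths_finite_paths[of fs B n v] fs S n
      unfolding tail_invariant_def by (metis subsetD)
    have mass: "emeasure \<mu> (\<Union>es\<in>R. cylinder B es) = of_nat (card R) * ?p" if R: "R \<subseteq> ?T" for R
    proof -
      have "emeasure \<mu> (\<Union>es\<in>R. cylinder B es) = (\<Sum>es\<in>R. emeasure \<mu> (cylinder B es))"
        using meas R disj finite_subset[OF R finT]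
        by (intro sum_emeasure[symmetric]) (auto intro: disjoint_family_on_mono)
      also have "\<dots> = (\<Sum>es\<in>R. ?p)" using R same by (intro sum.cong) auto
      finally show ?thesis by simp
    qed
    have "of_nat (card S) \<le> ennreal c * of_nat (card ?T)"
      using c by (simp add: ennreal_of_nat_eq_real_of_nat ennreal_mult[symmetric] ennreal_leI)
    then have "of_nat (card S) * ?p \<le> ennreal c * of_nat (card ?T) * ?p"
      by (rule mult_right_mono) simp
    then show ?thesis using mass[OF S] mass[OF order_refl] by (simp add: mult.assoc)
  qed simp
qed

section \<open>Mass of the paths through a vertex\<close>

text \<open>In the proof, \<open>P v\<close> consists of the paths through \<open>v\<close> at level \<open>k + m\<close> and \<open>Q v\<close> of those among
  them that visit \<open>w\<close> at level \<open>k\<close>. The bound of the mass of \<open>Q v\<close> by that of \<open>P v\<close> is uniform in \<open>v\<close>,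
  and it is summed over the countably many \<open>v\<close>, for which the masses of the sets \<open>P v\<close> add up to \<open>1\<close>.\<close>

lemma measure_through_vertex_le:
  assumes B: "generalized_bratteli_diagram B" and \<mu>: "prob_space \<mu>" "tail_invariant B \<mu>"
    and w: "w \<in> verts B k" and m: "0 < m"
  shows "{x \<in> path_space B. src B (x k) = w} \<in> sets \<mu>"
    and "ereal (measure \<mu> {x \<in> path_space B. src B (x k) = w}) \<le>
      (SUP v\<in>verts B (k + m). ereal (real (vertex_height B k w) * real (path_count B (k + m) k v w)
         / real (vertex_height B (k + m) v)))"
      (is "_ \<le> ?s")
proof -
  interpret prob_space \<mu> by (rule \<mu>(1))
  let ?n = "k + m"
  let ?X = "{x \<in> path_space B. src B (x k) = w}"
  let ?r = "\<lambda>v. real (vertex_height B k w) * real (path_count B ?n k v w) / real (vertex_height B ?n v)"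
  define P where "P v = (\<Union>es\<in>initial_paths B ?n v. cylinder B es)" for v
  define Q where "Q v = (\<Union>es\<in>initial_paths_through B k w m v. cylinder B es)" for v
  have n: "0 < ?n" using m by simp
  have countable: "countable (verts B ?n)" and nonempty: "verts B ?n \<noteq> {}"
    using B by (auto simp: generalized_bratteli_diagram_def dest!: spec[of _ ?n])
  have space: "space \<mu> = path_space B"
    using \<mu>(2) sets_eq_imp_space_eq space_path_borel by (metis tail_invariant_def)
  have src: "src B (x ?n) \<in> verts B ?n" if "x \<in> path_space B" for x
    using that src_in_verts[OF B] by (auto simp: path_space_def)
  have len: "length es = ?n" if "es \<in> initial_paths B ?n v" for es v
    using initial_paths_valid[OF that] by simp
  have P_eq: "P v = {x \<in> path_space B. src B (x ?n) = v}" for v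
    unfolding P_def using prefix_mem_initial_paths_iff[of _ B ?n v] n
    by (fastforce simp: mem_cylinder_iff len)
  have Q_eq: "Q v = {x \<in> path_space B. src B (x ?n) = v \<and> src B (x k) = w}" for v
    unfolding Q_def
    using prefix_mem_initial_paths_through_iff[of _ B m k w v] m
    by (fastforce simp: mem_cylinder_iff len[OF subsetD[OF initial_paths_through_subset]])
  have P_sets: "P v \<in> sets \<mu>" if "v \<in> verts B ?n" for v
    unfolding P_def using emeasure_cylinders_le(1)[OF B \<mu>(2) that n order_refl, of 1] by simp
  have card_le: "card (initial_paths_through B k w m v) \<le> card (initial_paths B ?n v)"
    if "v \<in> verts B ?n" for v
    using finite_extensions[of B 0 "\<lambda>_. {[]}" v ?n] B that
    by (intro card_mono initial_paths_through_subset) auto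
  have Q_sets: "Q v \<in> sets \<mu>" if "v \<in> verts B ?n" for v
    unfolding Q_def
    using emeasure_cylinders_le(1)[OF B \<mu>(2) that n initial_paths_through_subset, of 1] card_le[OF that]
    by simp
  have X_eq: "?X = (\<Union>v\<in>verts B ?n. Q v)" using src by (auto simp: Q_eq)
  then show X_sets: "?X \<in> sets \<mu>" using Q_sets countable by (simp add: sets.countable_UN'')
  have space_eq: "space \<mu> = (\<Union>v\<in>verts B ?n. P v)" using src by (auto simp: P_eq space)
  have r_le: "ereal (?r v) \<le> ?s" if "v \<in> verts B ?n" for v
    using that by (rule SUP_upper)
  show "ereal (measure \<mu> ?X) \<le> ?s"
  proof (cases ?s)
    case (real s)
    have s: "?r v \<le> s" if "v \<in> verts B ?n" for v using r_le[OF that] real by simp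
    have "0 \<le> s"
    proof -
      obtain v where "v \<in> verts B ?n" using nonempty by auto
      moreover have "0 \<le> ?r v" by simp
      ultimately show ?thesis using s by (meson order_trans)
    qed
    have Q_le: "emeasure \<mu> (Q v) \<le> ennreal s * emeasure \<mu> (P v)" if v: "v \<in> verts B ?n" for v
    proof -
      have "real (card (initial_paths_through B k w m v)) \<le> s * real (card (initial_paths B ?n v))"
      \<comment> \<open>A height \<open>0\<close> would turn the ratio into the default value \<open>0\<close>, which bounds nothing.\<close>
      proof (cases "vertex_height B ?n v = 0")
        case True
        then show ?thesis using card_le[OF v] card_initial_paths[OF B v] by simp
      next
        case False
        then show ?thesis
          using s[OF v] card_initial_paths[OF B v] card_initial_paths_through[OF B w v]
          by (simp add: divide_le_eq)
      qed
      then show ?thesis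
        unfolding P_def Q_def
        using emeasure_cylinders_le(2)[OF B \<mu>(2) v n initial_paths_through_subset \<open>0 \<le> s\<close>] by blast
    qed
    have "emeasure \<mu> ?X = (\<integral>\<^sup>+v. emeasure \<mu> (Q v) \<partial>count_space (verts B ?n))"
      unfolding X_eq using Q_sets countable
      by (intro emeasure_UN_countable) (auto simp: disjoint_family_on_def Q_eq)
    also have "\<dots> \<le> (\<integral>\<^sup>+v. ennreal s * emeasure \<mu> (P v) \<partial>count_space (verts B ?n))"
      using Q_le by (intro nn_integral_mono) auto
    also have "\<dots> = ennreal s * (\<integral>\<^sup>+v. emeasure \<mu> (P v) \<partial>count_space (verts B ?n))"
      by (rule nn_integral_cmult) simp
    also have "(\<integral>\<^sup>+v. emeasure \<mu> (P v) \<partial>count_space (verts B ?n)) = emeasure \<mu> (space \<mu>)"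
      unfolding space_eq using P_sets countable
      by (intro emeasure_UN_countable[symmetric]) (auto simp: disjoint_family_on_def P_eq)
    finally have "ennreal (measure \<mu> ?X) \<le> ennreal s"
      by (simp add: emeasure_eq_measure prob_space)
    then show ?thesis using real \<open>0 \<le> s\<close> by simp
  next
    case MInf
    then show ?thesis using nonempty r_le by auto
  qed simp
qed

theorem theorem3p6:
  fixes B :: "('v, 'e) bratteli"
  assumes "generalized_bratteli_diagram B"
    and "no_isolated_points B"
    and "tail_aperiodic B"
    and "\<exists>k. \<forall>W. finite W \<and> W \<subseteq> verts B k \<longrightarrow>
      liminf (\<lambda>n. SUP v\<in>verts B n.
        ereal ((\<Sum>w\<in>W. real (vertex_height B k w) * real (path_count B n k v w)) / real (vertex_height B n v))) = 0"
  shows "\<not> (\<exists>\<mu>. prob_space \<mu> \<and> tail_invariant B \<mu>)"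
proof
  assume "\<exists>\<mu>. prob_space \<mu> \<and> tail_invariant B \<mu>"
  then obtain \<mu> where \<mu>: "prob_space \<mu>" "tail_invariant B \<mu>" by blast
  interpret prob_space \<mu> by (rule \<mu>(1))
  note B = assms(1)
  from assms(4) obtain k where k: "liminf (\<lambda>n. SUP v\<in>verts B n.
      ereal ((\<Sum>w\<in>W. real (vertex_height B k w) * real (path_count B n k v w))
        / real (vertex_height B n v))) = 0" if "finite W" "W \<subseteq> verts B k" for W
    by blast
  define X where "X w = {x \<in> path_space B. src B (x k) = w}" for w
  have null: "X w \<in> null_sets \<mu>" if w: "w \<in> verts B k" for w
  proof -
    let ?s = "\<lambda>n. SUP v\<in>verts B n.
      ereal (real (vertex_height B k w) * real (path_count B n k v w) / real (vertex_height B n v))"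
    have "ereal (measure \<mu> (X w)) \<le> ?s n" if "k < n" for n
      using measure_through_vertex_le(2)[OF B \<mu> w, of "n - k"] that by (simp add: X_def)
    then have "ereal (measure \<mu> (X w)) \<le> liminf ?s"
      by (intro Liminf_bounded eventually_mono[OF eventually_gt_at_top[of k]])
    also have "\<dots> = 0" using k[of "{w}"] w by simp
    finally have "measure \<mu> (X w) = 0" by (simp add: measure_le_0_iff)
    moreover have "X w \<in> sets \<mu>"
      unfolding X_def by (rule measure_through_vertex_le(1)[OF B \<mu> w zero_less_one])
    ultimately show ?thesis by (auto simp: null_sets_def emeasure_eq_measure)
  qed
  have "space \<mu> = path_space B"
    using \<mu>(2) sets_eq_imp_space_eq space_path_borel by (metis tail_invariant_def)
  also have "\<dots> = (\<Union>w\<in>verts B k. X w)"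
    using src_in_verts[OF B] by (auto simp: X_def path_space_def)
  also have "\<dots> \<in> null_sets \<mu>"
    using null B by (intro null_sets_UN') (auto simp: generalized_bratteli_diagram_def)
  finally show False using emeasure_space_1 by auto
qed

end
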